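(* Let $g(t)=\dfrac{1}{e^t+1}$. Then: (1) $g^{(2m)}(0)=0$ for all integers $m\geq 1$. (2) $g^{(4m+1)}(0)<0$ for all integers $m\geq 0$. (3) $g^{(4m-1)}(0)>0$ for all integers $m\geq 1$. (4) For all integers $m\geq 1$, $$\frac{g^{(2m-1)}(0)}{(2m-1)!}=(-1)^m(1-2^{-2m})\,\zeta(2m)\,\frac{2}{\pi^{2m}}.$$ (5) For all integers $m\geq 2$, $$-\frac{g^{(4m+1)}(0)}{(4m+1)!}\pi^2<\frac{g^{(4m-1)}(0)}{(4m-1)!}<-1.00013814\,\frac{g^{(4m+1)}(0)}{(4m+1)!}\pi^2.$$ (6) For all integers $m\geq 1$, $$\frac{2}{\pi^{2m}}<\frac{\vert g^{(2m-1)}(0)\vert}{(2m-1)!}=(1-2^{-2m})\,\zeta(2m)\,\frac{2}{\pi^{2m}}.$$ (7) For all real $t$, $$g(t)=\frac12-\frac12\tanh\frac t2.$$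
   Context: $g^{(n)}(0)$ denotes the $n$-th derivative of $g$ at $0$. $\zeta$ is the Riemann zeta function. *)

theory Defs
  imports "HOL-Analysis.Analysis"
begin

text \<open>
  The Riemann zeta function on the real half-line \<open>s > 1\<close>, where it is given by its Dirichlet
  series. Outside that range the series diverges and the value is meaningless (no analytic
  continuation is attempted).
\<close>

definition zeta :: "real \<Rightarrow> real" where
  "zeta s = (\<Sum>n. 1 / real (Suc n) powr s)"

end

theory Submission imports Defs begin

text \<open>
  The logistic function is \<open>1 / (e\<^sup>t + 1) = 1/2 - tanh (t/2) / 2\<close>, so its derivatives at \<open>0\<close> are read
  off from the Taylor series of the odd function \<open>tanh (t/2)\<close>. The poles of the latter are the odd
  multiples of \<open>\<pi> \<i>\<close>, and pairing conjugate poles gives the partial fraction expansion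
  \<open>tanh (t/2) = \<Sum>n. 4 t / (t\<^sup>2 + ((2 n + 1) \<pi>)\<^sup>2)\<close> (\<open>tanh_half_partial_fractions\<close>). It is obtained here from
  the reflection formula of the digamma function on the line \<open>Re z = 1/2\<close>, where the cotangent
  turns into a hyperbolic tangent.

  Expanding every fraction into a geometric series in \<open>t\<^sup>2\<close> and adding up equal powers shows that the
  coefficient of \<open>t ^ (2 m - 1)\<close> is \<open>\<plusminus> 4 \<lambda>(2 m) / \<pi> ^ (2 m)\<close>, where \<open>\<lambda>(s)\<close>, the
  \<open>dirichlet_lambda\<close> below, is the sum of the inverse \<open>s\<close>-th powers of the odd numbers
  (\<open>tanh_half_power_series\<close>). Splitting the zeta series by parity gives \<open>\<lambda>(s) = (1 - 1/2\<^sup>s) \<zeta>(s)\<close>.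

  After this all claims are statements about \<open>\<lambda>\<close>. The signs and the lower bound
  \<open>2 / \<pi> ^ (2 m)\<close> come from \<open>\<lambda>(2 m) > 1\<close>. The comparison of consecutive odd derivatives says
  \<open>1 < \<lambda>(s) / \<lambda>(s + 2) < 1.00013814\<close> for \<open>s = 4 m \<ge> 8\<close>. At \<open>s = 8\<close> the quotient is about
  \<open>1.0001381353\<close>, so the constant leaves little room there and the proof is numerical; larger \<open>s\<close>
  reduce to \<open>s = 8\<close> term by term (\<open>dirichlet_lambda_quotient_bound\<close>).
\<close>


section \<open>Derivatives at the centre of a power series\<close>

text \<open>
  Taylor's formula for real as well as complex functions: differentiating a convergent expansion
  termwise shifts its coefficients and multiplies them by the index, which builds up the factorial.
\<close>

lemma higher_deriv_0_has_fps_expansion: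
  fixes f :: "'a :: {banach, real_normed_field} \<Rightarrow> 'a"
  assumes "f has_fps_expansion F"
  shows "(deriv ^^ n) f 0 = fact n * fps_nth F n"
  using assms
proof (induction n arbitrary: f F)
  case 0
  then show ?case by (auto simp: has_fps_expansion_def eval_fps_at_0 dest: eventually_nhds_x_imp_x)
next
  case (Suc n)
  have "(deriv ^^ Suc n) f 0 = (deriv ^^ n) (deriv f) 0"
    unfolding funpow_Suc_right o_def ..
  also have "\<dots> = fact n * fps_nth (fps_deriv F) n"
    by (rule Suc.IH) (intro has_fps_expansion_deriv Suc.prems)
  also have "\<dots> = fact (Suc n) * fps_nth F (Suc n)"
    by (simp add: algebra_simps)
  finally show ?case .
qed


section \<open>The Dirichlet lambda function at positive integers\<close>

definition dirichlet_lambda :: "nat \<Rightarrow> real" where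
  "dirichlet_lambda s = (\<Sum>n. 1 / (2 * real n + 1) ^ s)"

lemma dirichlet_lambda_sums:
  assumes "s \<ge> 2"
  shows "(\<lambda>n. 1 / (2 * real n + 1) ^ s) sums dirichlet_lambda s"
proof -
  have "summable (\<lambda>n. inverse ((1 + real n) ^ s))"
    by (rule Polygamma_converges') (use assms in auto)
  then have "summable (\<lambda>n. 1 / (2 * real n + 1) ^ s)"
    by (rule summable_comparison_test'[where N = 0])
       (auto simp: field_simps intro!: power_mono)
  then show ?thesis
    unfolding dirichlet_lambda_def by (rule summable_sums)
qed

lemma dirichlet_lambda_gt_1:
  assumes "s \<ge> 2"
  shows "dirichlet_lambda s > 1"
proof -
  have "(\<Sum>n<2. 1 / (2 * real n + 1) ^ s) \<le> dirichlet_lambda s"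
    by (rule sum_le_suminf[OF sums_summable[OF dirichlet_lambda_sums[OF assms]],
          folded dirichlet_lambda_def]) auto
  then show ?thesis
    by (simp add: numeral_2_eq_2 order.strict_trans2[rotated])
qed

lemma dirichlet_lambda_strict_antimono:
  assumes "2 \<le> s" "s < s'"
  shows "dirichlet_lambda s' < dirichlet_lambda s"
proof -
  define d where "d n = 1 / (2 * real n + 1) ^ s - 1 / (2 * real n + 1) ^ s'" for n
  have sums: "d sums (dirichlet_lambda s - dirichlet_lambda s')"
    unfolding d_def by (intro sums_diff dirichlet_lambda_sums) (use assms in auto)
  have "d n \<ge> 0" for n
    using assms by (auto simp: d_def intro!: divide_left_mono power_increasing)
  moreover have "d 1 > 0"
    using assms by (simp add: d_def divide_strict_left_mono)
  ultimately have "0 < suminf d"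
    by (rule suminf_pos2[OF sums_summable[OF sums]])
  then show ?thesis using sums_unique[OF sums] by simp
qed

text \<open>
  The terms of the zeta series are grouped in pairs; the even members of the pairs add up to
  \<open>1 / 2\<^sup>s\<close> times the whole series.
\<close>

lemma dirichlet_lambda_eq_zeta:
  assumes "s \<ge> 2"
  shows "dirichlet_lambda s = (1 - 1 / 2 ^ s) * zeta (real s)"
proof -
  have "summable (\<lambda>n. inverse ((1 + real n) ^ s))"
    by (rule Polygamma_converges') (use assms in auto)
  then have "summable (\<lambda>n. 1 / real (Suc n) powr real s)"
    by (simp add: powr_realpow field_simps)
  then have z: "(\<lambda>n. 1 / real (Suc n) ^ s) sums zeta (real s)"
    unfolding zeta_def by (simp add: powr_realpow summable_sums del: of_nat_Suc)
  have "(\<lambda>n. 1 / (2 * real n + 1) ^ s + 1 / 2 ^ s * (1 / real (Suc n) ^ s)) sums zeta (real s)"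
  proof -
    have "sum (\<lambda>n. 1 / real (Suc n) ^ s) {n * 2..<n * 2 + 2} =
          1 / (2 * real n + 1) ^ s + 1 / 2 ^ s * (1 / real (Suc n) ^ s)" for n
    proof -
      have "{n * 2..<n * 2 + 2} = {2 * n, 2 * n + 1}" by auto
      moreover have "real (Suc (2 * n + 1)) = 2 * real (Suc n)" by simp
      ultimately show ?thesis
        by (simp add: power_mult_distrib add_ac del: of_nat_Suc) (simp add: add_ac)
    qed
    then show ?thesis using sums_group[OF z, of 2] by simp
  qed
  from sums_diff[OF this sums_mult[OF z, of "1 / 2 ^ s"]]
  have "(\<lambda>n. 1 / (2 * real n + 1) ^ s) sums (zeta (real s) - 1 / 2 ^ s * zeta (real s))"
    by simp
  with dirichlet_lambda_sums[OF assms] have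
    "dirichlet_lambda s = zeta (real s) - 1 / 2 ^ s * zeta (real s)"
    by (rule sums_unique2)
  then show ?thesis by (simp add: algebra_simps)
qed

text \<open>
  The tail is compared with a telescoping series: for \<open>x \<ge> N\<close>, all but two of the \<open>s\<close> factors
  \<open>2 x + 1\<close> are bounded below by \<open>2 N + 1\<close>, and the remaining square by \<open>4 x (x + 1)\<close>.
\<close>

lemma dirichlet_lambda_upper_bound:
  assumes "s \<ge> 2" "N \<ge> 1"
  shows "dirichlet_lambda s \<le>
           (\<Sum>n<N. 1 / (2 * real n + 1) ^ s) + 1 / (4 * real N * (2 * real N + 1) ^ (s - 2))"
proof -
  define C where "C = 1 / (4 * (2 * real N + 1) ^ (s - 2))"
  have C: "C \<ge> 0" by (simp add: C_def)
  have "(\<lambda>n. 1 / (real n + real N)) \<longlonglongrightarrow> 0"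
    using LIMSEQ_ignore_initial_segment[OF lim_1_over_n[where 'a = real], of N] by simp
  from telescope_sums'[OF this]
  have tel: "(\<lambda>n. C * (1 / (real n + real N) - 1 / (real (Suc n) + real N))) sums (C * (1 / real N))"
    using sums_mult by force
  have tail: "(\<lambda>n. 1 / (2 * real (n + N) + 1) ^ s) sums
          (dirichlet_lambda s - (\<Sum>n<N. 1 / (2 * real n + 1) ^ s))"
    using sums_split_initial_segment[OF dirichlet_lambda_sums[OF assms(1)], of N] by simp
  have "1 / (2 * real (n + N) + 1) ^ s \<le>
        C * (1 / (real n + real N) - 1 / (real (Suc n) + real N))" for n
  proof -
    define x where "x = real (n + N)"
    have x: "x \<ge> 1" "real N \<le> x" using assms by (simp_all add: x_def)
    have "(2 * x + 1) ^ s = (2 * x + 1) ^ (s - 2) * (2 * x + 1) ^ 2"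
      using assms by (metis le_add_diff_inverse2 power_add)
    moreover have "(2 * real N + 1) ^ (s - 2) \<le> (2 * x + 1) ^ (s - 2)"
      by (rule power_mono) (use x in auto)
    moreover have "4 * (x * (x + 1)) \<le> (2 * x + 1) ^ 2"
      by (simp add: power2_eq_square algebra_simps)
    ultimately have le: "(2 * real N + 1) ^ (s - 2) * (4 * (x * (x + 1))) \<le> (2 * x + 1) ^ s"
      using x by (simp only:) (intro mult_mono; simp)
    have "1 / (2 * x + 1) ^ s \<le> 1 / ((2 * real N + 1) ^ (s - 2) * (4 * (x * (x + 1))))"
      by (rule divide_left_mono[OF le]) (use x in \<open>auto intro!: mult_pos_pos\<close>)
    also have "\<dots> = C * (1 / x - 1 / (x + 1))"
      using x by (simp add: C_def field_simps)
    finally show ?thesis by (simp add: x_def add_ac)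
  qed
  from sums_le[OF this tail tel] show ?thesis
    by (simp add: C_def mult_ac)
qed

text \<open>
  With \<open>c\<close> the constant on the right, the claim is that the series with terms
  \<open>(1 - c / x\<^sup>2) / x\<^sup>s\<close>, over odd \<open>x\<close>, has a negative sum. Only the term at \<open>x = 1\<close> is negative, and it
  does not depend on \<open>s\<close>; all others are positive and decrease in \<open>s\<close>. So \<open>s = 8\<close> is the worst case,
  which is a numerical estimate.
\<close>

lemma dirichlet_lambda_quotient_bound:
  assumes "s \<ge> 8"
  shows "dirichlet_lambda s < 1.00013814 * dirichlet_lambda (s + 2)"
proof -
  define c :: real where "c = 1.00013814"
  define d where "d s n = 1 / (2 * real n + 1) ^ s - c * (1 / (2 * real n + 1) ^ (s + 2))" for s n
  have d_sums: "d s sums (dirichlet_lambda s - c * dirichlet_lambda (s + 2))" if "s \<ge> 2" for s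
    unfolding d_def using that by (intro sums_diff sums_mult dirichlet_lambda_sums) auto
  have "d s n \<le> d 8 n" for n
  proof (cases "n = 0")
    case False
    define x where "x = 2 * real n + 1"
    have x: "x \<ge> 3" using False by (simp add: x_def)
    have eq: "d r n = 1 / x ^ r * (1 - c / x ^ 2)" for r
      by (simp add: d_def x_def power_add power2_eq_square algebra_simps)
    have "c / x ^ 2 \<le> 1"
      using x power_mono[of 3 x 2] by (simp add: c_def field_simps)
    moreover have "1 / x ^ s \<le> 1 / x ^ 8"
      by (intro divide_left_mono power_increasing) (use x assms in auto)
    ultimately show ?thesis unfolding eq by (intro mult_right_mono) auto
  qed (simp add: d_def)
  then have "dirichlet_lambda s - c * dirichlet_lambda (s + 2) \<le>
             dirichlet_lambda 8 - c * dirichlet_lambda 10"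
    using sums_le[OF _ d_sums[of s] d_sums[of 8]] assms by simp
  also have "\<dots> < 0"
  proof -
    \<comment> \<open>The two sides differ by less than \<open>5e-9\<close>. Stopping at \<open>13\<close> leaves a tail bound of about
        \<open>3e-9\<close> for exponent \<open>8\<close>; for exponent \<open>10\<close> the terms after \<open>9\<close> are below \<open>1e-10\<close>.\<close>
    have "dirichlet_lambda 8 \<le> (\<Sum>n<7. 1 / (2 * real n + 1) ^ 8) + 1 / (4 * 7 * 15 ^ 6)"
      using dirichlet_lambda_upper_bound[of 8 7] by simp
    also have "\<dots> < c * (\<Sum>n<5. 1 / (2 * real n + 1) ^ 10)"
      by (simp add: c_def lessThan_nat_numeral lessThan_Suc)
    also have "\<dots> \<le> c * dirichlet_lambda 10"
      using sum_le_suminf[OF sums_summable[OF dirichlet_lambda_sums[of 10]], of "{..<5}"]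
      by (auto simp: dirichlet_lambda_def c_def)
    finally show ?thesis by simp
  qed
  finally show ?thesis by (simp add: c_def)
qed


section \<open>Partial fractions of the hyperbolic tangent\<close>

text \<open>The logarithmic derivative of Euler's reflection formula for the Gamma function.\<close>

lemma Digamma_reflection:
  fixes z :: complex
  assumes "z \<notin> \<int>"
  shows "Digamma (1 - z) - Digamma z = of_real pi * cot (of_real pi * z)"
proof -
  have sin: "sin (of_real pi * w) \<noteq> 0" if "w \<notin> \<int>" for w :: complex
    using that by (auto simp: sin_eq_0 Ints_def)
  have nonpos: "z \<notin> \<int>\<^sub>\<le>\<^sub>0" "1 - z \<notin> \<int>\<^sub>\<le>\<^sub>0"
    using assms Ints_diff[of 1 "1 - z"] by auto
  have "((\<lambda>z. Gamma z * Gamma (1 - z)) has_field_derivative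
          Gamma z * Gamma (1 - z) * (Digamma z - Digamma (1 - z))) (at z)"
    using nonpos by (auto intro!: derivative_eq_intros simp: algebra_simps)
  moreover have "(\<lambda>z. Gamma z * Gamma (1 - z)) = (\<lambda>z. of_real pi / sin (of_real pi * z :: complex))"
    by (simp add: Gamma_reflection_complex)
  moreover have "((\<lambda>z. of_real pi / sin (of_real pi * z)) has_field_derivative
          - (of_real pi / sin (of_real pi * z)) * (of_real pi * cot (of_real pi * z))) (at z)"
    using sin[OF assms]
    by (auto intro!: derivative_eq_intros simp: cot_def field_simps power2_eq_square)
  ultimately have "Gamma z * Gamma (1 - z) * (Digamma z - Digamma (1 - z)) =
      - (Gamma z * Gamma (1 - z)) * (of_real pi * cot (of_real pi * z))"
    using DERIV_unique by (metis Gamma_reflection_complex)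
  moreover have "Gamma z * Gamma (1 - z) \<noteq> 0"
    using sin[OF assms] by (simp add: Gamma_reflection_complex)
  ultimately have "Digamma z - Digamma (1 - z) = - (of_real pi * cot (of_real pi * z))"
    by (metis minus_mult_commute mult_cancel_left)
  then show ?thesis by (simp add: algebra_simps)
qed

lemma cot_half_plus_i:
  fixes w :: complex
  shows "cot (of_real pi * (1 / 2 + \<i> * w)) = - \<i> * tanh (of_real pi * w)"
proof -
  have "of_real pi * (1 / 2 + \<i> * w) = of_real (pi / 2) + \<i> * (of_real pi * w)"
    by (simp add: algebra_simps)
  then show ?thesis
    by (simp add: cot_def sin_add cos_add tanh_def sinh_conv_sin cosh_conv_cos sin_of_real cos_of_real
          del: of_real_divide)
qed

text \<open>
  On \<open>z = 1/2 + \<i> w\<close> with \<open>w\<close> real, \<open>1 - z\<close> is the complex conjugate of \<open>z\<close>. The difference of the two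
  digamma series therefore has purely imaginary terms, and these are the partial fractions of
  \<open>tanh (\<pi> w)\<close> up to a constant factor.
\<close>

lemma tanh_half_partial_fractions:
  fixes t :: real
  shows "(\<lambda>n. 4 * t / (t\<^sup>2 + ((2 * real n + 1) * pi)\<^sup>2)) sums tanh (t / 2)"
proof -
  \<comment> \<open>chosen such that \<open>\<pi> w = t / 2\<close>\<close>
  define w where "w = t / (2 * pi)"
  define z :: complex where "z = 1 / 2 + \<i> * of_real w"
  have Re: "Re z = 1 / 2" "Re (1 - z) = 1 / 2" by (simp_all add: z_def)
  then have nz: "z \<noteq> 0" "1 - z \<noteq> 0" by (metis zero_complex.sel(1) divide_eq_0_iff one_neq_zero zero_neq_numeral)+
  have z: "z \<notin> \<int>"
  proof
    assume "z \<in> \<int>"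
    then obtain k where "z = of_int k" by (auto elim: Ints_cases)
    with Re have "real_of_int k = 1 / 2" by simp
    then have "real_of_int (2 * k) = real_of_int 1" by simp
    then have "2 * k = 1" by (simp only: of_int_eq_iff)
    then show False by presburger
  qed
  have dig: "(\<lambda>n. inverse (of_nat (Suc n)) - inverse (u + of_nat n)) sums
               (Digamma u + euler_mascheroni)" if "u \<noteq> 0" for u :: complex
    using summable_sums[OF summable_Digamma[OF that]] by (simp add: Digamma_def)
  have "(\<lambda>n. inverse (z + of_nat n) - inverse (1 - z + of_nat n)) sums (Digamma (1 - z) - Digamma z)"
    using sums_diff[OF dig[OF nz(2)] dig[OF nz(1)]] by simp
  also have "Digamma (1 - z) - Digamma z = of_real pi * (- \<i> * tanh (of_real pi * of_real w))"
    unfolding Digamma_reflection[OF z] by (simp only: z_def cot_half_plus_i)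
  also have "tanh (of_real pi * of_real w) = (of_real (tanh (pi * w)) :: complex)"
    by (simp add: tanh_altdef exp_of_real flip: of_real_mult of_real_minus)
  finally have "(\<lambda>n. \<i> / of_real pi * (inverse (z + of_nat n) - inverse (1 - z + of_nat n))) sums
      (\<i> / of_real pi * (of_real pi * (- \<i> * of_real (tanh (pi * w)))))"
    by (rule sums_mult)
  also have "\<i> / of_real pi * (of_real pi * (- \<i> * of_real (tanh (pi * w)))) =
               complex_of_real (tanh (t / 2))"
    by (simp add: w_def)
  also have "(\<lambda>n. \<i> / of_real pi * (inverse (z + of_nat n) - inverse (1 - z + of_nat n))) =
      (\<lambda>n. complex_of_real (4 * t / (t\<^sup>2 + ((2 * real n + 1) * pi)\<^sup>2)))"
  proof
    fix n
    define x where "x = real n + 1 / 2"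
    have x: "x > 0" by (simp add: x_def)
    have pos: "x\<^sup>2 + w\<^sup>2 > 0" using x by (simp add: add_pos_nonneg)
    have eqs: "z + of_nat n = of_real x + \<i> * of_real w" "1 - z + of_nat n = of_real x - \<i> * of_real w"
      by (simp_all add: z_def x_def)
    have nz: "of_real x + \<i> * of_real w \<noteq> 0" "of_real x - \<i> * of_real w \<noteq> (0 :: complex)"
      using x by (auto simp: complex_eq_iff)
    have prod: "(of_real x + \<i> * of_real w) * (of_real x - \<i> * of_real w) = complex_of_real (x\<^sup>2 + w\<^sup>2)"
      by (simp add: algebra_simps power2_eq_square)
    have "inverse (z + of_nat n) - inverse (1 - z + of_nat n) =
            (- 2 * \<i> * of_real w) / of_real (x\<^sup>2 + w\<^sup>2)"
      unfolding eqs prod[symmetric] using nz by (simp add: field_simps)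
    then have "\<i> / of_real pi * (inverse (z + of_nat n) - inverse (1 - z + of_nat n)) =
            complex_of_real (2 * w / (pi * (x\<^sup>2 + w\<^sup>2)))"
      by (simp add: mult_ac)
    also have "2 * w / (pi * (x\<^sup>2 + w\<^sup>2)) = 4 * t / (t\<^sup>2 + ((2 * real n + 1) * pi)\<^sup>2)"
    proof -
      have "t = 2 * pi * w" by (simp add: w_def)
      moreover have "2 * real n + 1 = 2 * x" by (simp add: x_def)
      moreover have "(2 * pi * w)\<^sup>2 + (2 * x * pi)\<^sup>2 = 4 * pi\<^sup>2 * (x\<^sup>2 + w\<^sup>2)"
        by (simp add: power2_eq_square algebra_simps)
      moreover have "2 * w / (pi * Q) = 4 * (2 * pi * w) / (4 * pi\<^sup>2 * Q)" if "Q > 0" for Q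
        using that by (simp add: field_simps power2_eq_square)
      ultimately show ?thesis using pos by (simp only:)
    qed
    finally show "\<i> / of_real pi * (inverse (z + of_nat n) - inverse (1 - z + of_nat n)) =
        complex_of_real (4 * t / (t\<^sup>2 + ((2 * real n + 1) * pi)\<^sup>2))" .
  qed
  finally show ?thesis by (subst (asm) sums_of_real_iff)
qed


section \<open>The Taylor series of the hyperbolic tangent\<close>

text \<open>
  The remainder is kept in closed form: it is the original fraction times a power of \<open>t / a\<close>. This
  permits summation over the poles \<open>a\<close> for a fixed number of powers of \<open>t\<close>, without exchanging two
  infinite sums.
\<close>

lemma geometric_expansion_with_remainder:
  fixes t a :: real
  assumes "a \<noteq> 0"
  shows "4 * t / (t\<^sup>2 + a\<^sup>2) =
           (\<Sum>j<J. 4 * (-1) ^ j * t ^ (2 * j + 1) * (1 / a ^ (2 * j + 2))) +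
           (-1) ^ J * (t / a) ^ (2 * J) * (4 * t / (t\<^sup>2 + a\<^sup>2))"
proof (induction J)
  case (Suc J)
  define y where "y = 4 * t / (t\<^sup>2 + a\<^sup>2)"
  have "t\<^sup>2 + a\<^sup>2 > 0" using assms by (simp add: add_nonneg_pos)
  then have "y * (t\<^sup>2 + a\<^sup>2) = 4 * t" by (simp add: y_def)
  then have "y = 4 * t / a\<^sup>2 - (t / a)\<^sup>2 * y"
    using assms by (simp add: field_simps)
  then have "(-1) ^ J * (t / a) ^ (2 * J) * y =
        (-1) ^ J * (t / a) ^ (2 * J) * (4 * t / a\<^sup>2 - (t / a)\<^sup>2 * y)"
    by simp
  also have "\<dots> = 4 * (-1) ^ J * t ^ (2 * J + 1) * (1 / a ^ (2 * J + 2)) +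
        (-1) ^ Suc J * (t / a) ^ (2 * Suc J) * y"
    by (simp add: right_diff_distrib diff_divide_distrib power_divide power_add power2_eq_square mult_ac)
  finally have "(-1) ^ J * (t / a) ^ (2 * J) * y = \<dots>" .
  with Suc.IH show ?case unfolding y_def[symmetric] by simp
qed simp

text \<open>
  The expansion is applied to each partial fraction with \<open>a = (2 n + 1) \<pi>\<close>. As \<open>a \<ge> \<pi>\<close>, the remainders
  are dominated by \<open>(t / \<pi>) ^ (2 J)\<close> times the partial fractions at \<open>\<bar>t\<bar>\<close>, whose sum is
  \<open>tanh (\<bar>t\<bar> / 2)\<close>. So the total remainder tends to \<open>0\<close> for \<open>\<bar>t\<bar> < \<pi>\<close>.
\<close>

lemma tanh_half_power_series:
  fixes t :: real
  assumes "\<bar>t\<bar> < pi"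
  shows "(\<lambda>j. 4 * (-1) ^ j * dirichlet_lambda (2 * j + 2) / pi ^ (2 * j + 2) * t ^ (2 * j + 1))
           sums tanh (t / 2)"
proof -
  define a where "a n = (2 * real n + 1) * pi" for n :: nat
  have a: "a n \<ge> pi" "a n > 0" for n
    using mult_right_mono[of 1 "2 * real n + 1" pi] by (simp_all add: a_def)
  define S where
    "S J = (\<Sum>j<J. 4 * (-1) ^ j * dirichlet_lambda (2 * j + 2) / pi ^ (2 * j + 2) * t ^ (2 * j + 1))" for J
  have bound: "\<bar>tanh (t / 2) - S J\<bar> \<le> (t / pi) ^ (2 * J) * tanh (\<bar>t\<bar> / 2)" for J
  proof -
    have "(\<lambda>n. \<Sum>j<J. 4 * (-1) ^ j * t ^ (2 * j + 1) * (1 / a n ^ (2 * j + 2))) sums S J"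
      unfolding S_def
    proof (rule sums_sum)
      fix j
      have "(\<lambda>n. 4 * (-1) ^ j * t ^ (2 * j + 1) / pi ^ (2 * j + 2) * (1 / (2 * real n + 1) ^ (2 * j + 2)))
          sums (4 * (-1) ^ j * t ^ (2 * j + 1) / pi ^ (2 * j + 2) * dirichlet_lambda (2 * j + 2))"
        by (intro sums_mult dirichlet_lambda_sums) simp
      then show "(\<lambda>n. 4 * (-1) ^ j * t ^ (2 * j + 1) * (1 / a n ^ (2 * j + 2))) sums
          (4 * (-1) ^ j * dirichlet_lambda (2 * j + 2) / pi ^ (2 * j + 2) * t ^ (2 * j + 1))"
        by (simp add: a_def power_mult_distrib mult_ac)
    qed
    note diff = sums_diff[OF tanh_half_partial_fractions[of t, folded a_def] this]
    have "4 * t / (t\<^sup>2 + (a n)\<^sup>2) - (\<Sum>j<J. 4 * (-1) ^ j * t ^ (2 * j + 1) * (1 / a n ^ (2 * j + 2))) =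
        (-1) ^ J * (t / a n) ^ (2 * J) * (4 * t / (t\<^sup>2 + (a n)\<^sup>2))" for n
      unfolding diff_eq_eq
      by (rule trans[OF geometric_expansion_with_remainder add.commute]) (use a(2)[of n] in simp)
    with diff
    have rem: "(\<lambda>n. (-1) ^ J * (t / a n) ^ (2 * J) * (4 * t / (t\<^sup>2 + (a n)\<^sup>2))) sums (tanh (t / 2) - S J)"
      by (simp only:)
    have dom: "(\<lambda>n. (t / pi) ^ (2 * J) * (4 * \<bar>t\<bar> / (t\<^sup>2 + (a n)\<^sup>2))) sums
           ((t / pi) ^ (2 * J) * tanh (\<bar>t\<bar> / 2))"
      using tanh_half_partial_fractions[of "\<bar>t\<bar>", folded a_def] by (intro sums_mult) simp
    have le: "\<bar>(-1) ^ J * (t / a n) ^ (2 * J) * (4 * t / (t\<^sup>2 + (a n)\<^sup>2))\<bar> \<le>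
        (t / pi) ^ (2 * J) * (4 * \<bar>t\<bar> / (t\<^sup>2 + (a n)\<^sup>2))" for n
    proof -
      have "(\<bar>t\<bar> / a n) ^ (2 * J) \<le> (\<bar>t\<bar> / pi) ^ (2 * J)"
        by (intro power_mono divide_left_mono mult_pos_pos divide_nonneg_pos) (use a in auto)
      then have "(t / a n) ^ (2 * J) \<le> (t / pi) ^ (2 * J)"
        by (simp add: power_divide power_even_abs)
      moreover have "\<bar>(-1) ^ J * (t / a n) ^ (2 * J) * (4 * t / (t\<^sup>2 + (a n)\<^sup>2))\<bar> =
          (t / a n) ^ (2 * J) * (4 * \<bar>t\<bar> / (t\<^sup>2 + (a n)\<^sup>2))"
      proof -
        have "(t / a n) ^ (2 * J) \<ge> 0" "t\<^sup>2 + (a n)\<^sup>2 \<ge> 0" by simp_all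
        then show ?thesis by (simp only: abs_mult abs_divide abs_of_nonneg) (simp add: power_abs)
      qed
      ultimately show ?thesis by (simp only:) (intro mult_right_mono; simp)
    qed
    have "norm (tanh (t / 2) - S J) \<le> (t / pi) ^ (2 * J) * tanh (\<bar>t\<bar> / 2)"
      using norm_sums_le[OF rem dom] le by simp
    then show ?thesis by simp
  qed
  have "\<bar>t / pi\<bar> < 1" using assms by simp
  then have "norm ((t / pi)\<^sup>2) < 1"
    by (simp only: real_norm_def abs_power2 abs_square_less_1)
  then have "(\<lambda>J. ((t / pi)\<^sup>2) ^ J * tanh (\<bar>t\<bar> / 2)) \<longlonglongrightarrow> 0 * tanh (\<bar>t\<bar> / 2)"
    by (intro tendsto_mult tendsto_const LIMSEQ_power_zero)
  then have "(\<lambda>J. (t / pi) ^ (2 * J) * tanh (\<bar>t\<bar> / 2)) \<longlonglongrightarrow> 0"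
    by (simp only: power_mult mult_zero_left)
  then have "(\<lambda>J. tanh (t / 2) - S J) \<longlonglongrightarrow> 0"
    by (rule Lim_null_comparison[rotated]) (use bound in simp)
  from tendsto_diff[OF tendsto_const[of "tanh (t / 2)"] this]
  have "S \<longlonglongrightarrow> tanh (t / 2)" by simp
  then show ?thesis unfolding sums_def S_def .
qed

definition tanh_half_fps :: "real fps" where
  "tanh_half_fps = Abs_fps (\<lambda>n. if even n then 0
      else 4 * (-1) ^ (n div 2) * dirichlet_lambda (n + 1) / pi ^ (n + 1))"

lemma has_fps_expansion_tanh_half: "(\<lambda>t. tanh (t / 2)) has_fps_expansion tanh_half_fps"
proof (rule has_fps_expansionI)
  have "eventually (\<lambda>t :: real. t \<in> {-pi<..<pi}) (nhds 0)"
    by (intro eventually_nhds_in_open) auto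
  then show "eventually (\<lambda>t. (\<lambda>n. fps_nth tanh_half_fps n * t ^ n) sums tanh (t / 2)) (nhds 0)"
  proof eventually_elim
    case (elim t)
    have "(\<lambda>j. fps_nth tanh_half_fps (2 * j + 1) * t ^ (2 * j + 1)) sums tanh (t / 2)"
      using tanh_half_power_series[of t] elim by (simp add: tanh_half_fps_def abs_less_iff)
    moreover have "fps_nth tanh_half_fps n * t ^ n = 0" if "n \<notin> range (\<lambda>j. 2 * j + 1)" for n
      using that by (auto simp: tanh_half_fps_def elim!: oddE)
    ultimately show ?case
      by (subst (asm) sums_mono_reindex[where g = "\<lambda>j. 2 * j + 1"
            and f = "\<lambda>n. fps_nth tanh_half_fps n * t ^ n"])
         (auto simp: strict_mono_def)
  qed
qed


section \<open>The logistic function\<close>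

lemma logistic_eq_tanh: "1 / (exp t + 1) = 1 / 2 - 1 / 2 * tanh (t / 2 :: real)"
proof -
  have "exp (t / 2) * exp (t / 2) = exp t" by (simp flip: exp_add)
  then have "tanh (t / 2) = (exp t - 1) / (exp t + 1)"
    by (simp add: tanh_altdef exp_minus divide_simps add_pos_pos)
  moreover have "exp t + 1 > 0" by (simp add: add_pos_pos)
  ultimately show ?thesis
    by (simp add: field_simps)
qed

lemma logistic_higher_deriv_0:
  assumes "n \<ge> 1"
  shows "(deriv ^^ n) (\<lambda>t :: real. 1 / (exp t + 1)) 0 / fact n = - fps_nth tanh_half_fps n / 2"
proof -
  have "(\<lambda>t :: real. 1 / (exp t + 1)) has_fps_expansion
          (fps_const (1 / 2) - fps_const (1 / 2) * tanh_half_fps)"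
    unfolding logistic_eq_tanh by (intro fps_expansion_intros has_fps_expansion_tanh_half)
  from higher_deriv_0_has_fps_expansion[OF this, of n] show ?thesis
    using assms by simp
qed

lemma logistic_odd_deriv_0:
  assumes "m \<ge> 1"
  shows "(deriv ^^ (2 * m - 1)) (\<lambda>t :: real. 1 / (exp t + 1)) 0 / fact (2 * m - 1) =
           (-1) ^ m * dirichlet_lambda (2 * m) * (2 / pi ^ (2 * m))"
proof -
  obtain k where k: "m = Suc k" using assms by (cases m) auto
  show ?thesis
    by (subst logistic_higher_deriv_0) (simp_all add: k tanh_half_fps_def)
qed

text \<open>
  Write \<open>c n\<close> for the Taylor coefficients and \<open>l\<close> for the sums over odd numbers. An odd index
  \<open>2 k - 1\<close> belongs to \<open>l (2 k)\<close> with sign \<open>(-1) ^ k\<close>, so \<open>4 m - 1\<close> and \<open>4 m + 1\<close> have opposite signs,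
  and multiplying the second coefficient by \<open>\<pi>\<^sup>2\<close> brings both to the common factor
  \<open>2 / \<pi> ^ (4 m)\<close>.
\<close>

theorem theorem4:
  fixes g :: "real \<Rightarrow> real"
  assumes g_def: "\<And>t. g t = 1 / (exp t + 1)"
  shows
    "(\<forall>m\<ge>1. (deriv ^^ (2 * m)) g 0 = 0) \<and>
     (\<forall>m. (deriv ^^ (4 * m + 1)) g 0 < 0) \<and>
     (\<forall>m\<ge>1. (deriv ^^ (4 * m - 1)) g 0 > 0) \<and>
     (\<forall>m\<ge>1. (deriv ^^ (2 * m - 1)) g 0 / fact (2 * m - 1) =
        (-1) ^ m * (1 - 1 / 2 ^ (2 * m)) * zeta (real (2 * m)) * (2 / pi ^ (2 * m))) \<and>
     (\<forall>m\<ge>2.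
        - ((deriv ^^ (4 * m + 1)) g 0 / fact (4 * m + 1)) * pi ^ 2
          < (deriv ^^ (4 * m - 1)) g 0 / fact (4 * m - 1) \<and>
        (deriv ^^ (4 * m - 1)) g 0 / fact (4 * m - 1)
          < - 1.00013814 * ((deriv ^^ (4 * m + 1)) g 0 / fact (4 * m + 1)) * pi ^ 2) \<and>
     (\<forall>m\<ge>1.
        2 / pi ^ (2 * m) < \<bar>(deriv ^^ (2 * m - 1)) g 0\<bar> / fact (2 * m - 1) \<and>
        \<bar>(deriv ^^ (2 * m - 1)) g 0\<bar> / fact (2 * m - 1) =
          (1 - 1 / 2 ^ (2 * m)) * zeta (real (2 * m)) * (2 / pi ^ (2 * m))) \<and>
     (\<forall>t. g t = 1 / 2 - 1 / 2 * tanh (t / 2))"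
proof -
  define c where "c n = (deriv ^^ n) g 0 / fact n" for n
  define l where "l = dirichlet_lambda"
  have g: "g = (\<lambda>t. 1 / (exp t + 1))" using g_def by blast
  have D: "(deriv ^^ n) g 0 = fact n * c n" for n by (simp add: c_def)
  have even: "c (2 * m) = 0" if "m \<ge> 1" for m
    using logistic_higher_deriv_0[of "2 * m"] that by (simp add: c_def g tanh_half_fps_def)
  have odd: "c (2 * m - 1) = (-1) ^ m * l (2 * m) * (2 / pi ^ (2 * m))" if "m \<ge> 1" for m
    using logistic_odd_deriv_0[OF that] by (simp add: c_def g l_def)
  have zeta: "l (2 * m) = (1 - 1 / 2 ^ (2 * m)) * zeta (real (2 * m))" if "m \<ge> 1" for m
    unfolding l_def by (rule dirichlet_lambda_eq_zeta) (use that in simp)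
  have l_gt: "l (2 * m) > 1" if "m \<ge> 1" for m
    unfolding l_def by (rule dirichlet_lambda_gt_1) (use that in simp)
  have c1: "c (4 * m + 1) = - (l (4 * m + 2) * (2 / pi ^ (4 * m + 2)))" for m
    using odd[of "2 * m + 1"] by (simp add: power_mult)
  have c3: "c (4 * m - 1) = l (4 * m) * (2 / pi ^ (4 * m))" if "m \<ge> 1" for m
    using odd[of "2 * m"] that by (simp add: power_mult)
  have abs: "\<bar>(deriv ^^ (2 * m - 1)) g 0\<bar> / fact (2 * m - 1) = l (2 * m) * (2 / pi ^ (2 * m))"
    if "m \<ge> 1" for m
    using odd[OF that] l_gt[OF that] by (simp add: D abs_mult power_abs)
  have ratio: "- c (4 * m + 1) * pi ^ 2 = l (4 * m + 2) * (2 / pi ^ (4 * m))" for m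
    unfolding c1 power_add by (simp add: field_simps)
  have neg: "c (4 * m + 1) < 0" for m
    using l_gt[of "2 * m + 1"] unfolding c1 by simp
  have pos: "c (4 * m - 1) > 0" if "m \<ge> 1" for m
    using l_gt[of "2 * m"] that unfolding c3[OF that] by simp
  have quotient: "- c (4 * m + 1) * pi ^ 2 < c (4 * m - 1) \<and>
      c (4 * m - 1) < - 1.00013814 * c (4 * m + 1) * pi ^ 2" if "m \<ge> 2" for m
  proof -
    have p: "2 / pi ^ (4 * m) > 0" by simp
    have "l (4 * m + 2) < l (4 * m)"
      unfolding l_def by (rule dirichlet_lambda_strict_antimono) (use that in auto)
    from mult_strict_right_mono[OF this p]
    have "- c (4 * m + 1) * pi ^ 2 < c (4 * m - 1)"
      using c3[of m] that unfolding ratio by simp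
    moreover have "l (4 * m) < 1.00013814 * l (4 * m + 2)"
      unfolding l_def by (rule dirichlet_lambda_quotient_bound) (use that in simp)
    from mult_strict_right_mono[OF this p]
    have "c (4 * m - 1) < 1.00013814 * (- c (4 * m + 1) * pi ^ 2)"
      using c3[of m] that unfolding ratio by simp
    ultimately show ?thesis by linarith
  qed
  have lower: "2 / pi ^ (2 * m) < l (2 * m) * (2 / pi ^ (2 * m))" if "m \<ge> 1" for m
    using mult_strict_right_mono[OF l_gt[OF that], of "2 / pi ^ (2 * m)"] by simp
  show ?thesis
  proof (intro conjI allI impI)
    fix m :: nat
    show "(deriv ^^ (4 * m + 1)) g 0 < 0"
      unfolding D using neg[of m] by (simp only: mult_pos_neg fact_gt_zero)
    show "g t = 1 / 2 - 1 / 2 * tanh (t / 2)" for t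
      unfolding g_def by (rule logistic_eq_tanh)
  next
    fix m :: nat
    assume m: "m \<ge> 1"
    show "(deriv ^^ (2 * m)) g 0 = 0"
      unfolding D even[OF m] by simp
    show "(deriv ^^ (4 * m - 1)) g 0 > 0"
      unfolding D using pos[OF m] by (simp only: mult_pos_pos fact_gt_zero)
    show "(deriv ^^ (2 * m - 1)) g 0 / fact (2 * m - 1) =
        (-1) ^ m * (1 - 1 / 2 ^ (2 * m)) * zeta (real (2 * m)) * (2 / pi ^ (2 * m))"
      unfolding c_def[symmetric] odd[OF m] zeta[OF m] by (simp only: mult.assoc)
    show "2 / pi ^ (2 * m) < \<bar>(deriv ^^ (2 * m - 1)) g 0\<bar> / fact (2 * m - 1)"
      unfolding abs[OF m] by (rule lower[OF m])
    show "\<bar>(deriv ^^ (2 * m - 1)) g 0\<bar> / fact (2 * m - 1) =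
          (1 - 1 / 2 ^ (2 * m)) * zeta (real (2 * m)) * (2 / pi ^ (2 * m))"
      unfolding abs[OF m] zeta[OF m] ..
  next
    fix m :: nat
    assume m: "m \<ge> 2"
    show "- ((deriv ^^ (4 * m + 1)) g 0 / fact (4 * m + 1)) * pi ^ 2
          < (deriv ^^ (4 * m - 1)) g 0 / fact (4 * m - 1)"
      unfolding c_def[symmetric] using quotient[OF m] by blast
    show "(deriv ^^ (4 * m - 1)) g 0 / fact (4 * m - 1)
          < - 1.00013814 * ((deriv ^^ (4 * m + 1)) g 0 / fact (4 * m + 1)) * pi ^ 2"
      unfolding c_def[symmetric] using quotient[OF m] by blast
  qed
qed

end
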